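(* For any $\alpha\in(0,1)$ and any $p,q>0$ there exist positive definite $2\times2$ matrices $A,B$ such that $R_{\alpha,p}(A,B)\not\le_{\mathrm{near}}\mathcal{A}_{\alpha,q}(A,B)$; hence also $R_{\alpha,p}(A,B)\not\le\mathcal{A}_{\alpha,q}(A,B)$ and $R_{\alpha,p}(A,B)\not\le_{\mathrm{chao}}\mathcal{A}_{\alpha,q}(A,B)$.
   Context: For positive definite $A,B$: $R_{\alpha,p}(A,B):=\bigl(A^{\frac{1-\alpha}{2}p}B^{\alpha p}A^{\frac{1-\alpha}{2}p}\bigr)^{1/p}$ and $\mathcal{A}_{\alpha,q}(A,B):=((1-\alpha)A^q+\alpha B^q)^{1/q}$. For positive definite $X,Y$: $X\le Y$ is the Loewner order; $X\le_{\mathrm{chao}}Y$ (chaotic order) means $\log X\le\log Y$; $X\le_{\mathrm{near}}Y$ (near order) means $X\#Y^{-1}\le I$, where $X\#Z:=X^{1/2}(X^{-1/2}ZX^{-1/2})^{1/2}X^{1/2}$ is the geometric mean. *)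

theory Defs
  imports "HOL-Analysis.Analysis"
begin

type_synonym 'n rmat = "real^'n^'n"

definition diag_mat :: "('n::finite \<Rightarrow> real) \<Rightarrow> 'n rmat" where
  "diag_mat d = (\<chi> i j. if i = j then d i else 0)"

definition sym_mat :: "'n::finite rmat \<Rightarrow> bool" where
  "sym_mat A \<longleftrightarrow> transpose A = A"

definition pos_def :: "'n::finite rmat \<Rightarrow> bool" where
  "pos_def A \<longleftrightarrow> sym_mat A \<and> (\<forall>x. x \<noteq> 0 \<longrightarrow> x \<bullet> (A *v x) > 0)"

definition pos_semidef :: "'n::finite rmat \<Rightarrow> bool" where
  "pos_semidef A \<longleftrightarrow> sym_mat A \<and> (\<forall>x. x \<bullet> (A *v x) \<ge> 0)"

definition mfun :: "(real \<Rightarrow> real) \<Rightarrow> 'n::finite rmat \<Rightarrow> 'n rmat" where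
  "mfun f A = (THE M. \<exists>U d. orthogonal_matrix U \<and> A = U ** diag_mat d ** transpose U
                        \<and> M = U ** diag_mat (f \<circ> d) ** transpose U)"

definition mpow :: "'n::finite rmat \<Rightarrow> real \<Rightarrow> 'n rmat" where
  "mpow A t = mfun (\<lambda>x. x powr t) A"

definition mlog :: "'n::finite rmat \<Rightarrow> 'n rmat" where
  "mlog A = mfun ln A"

definition loewner_le :: "'n::finite rmat \<Rightarrow> 'n rmat \<Rightarrow> bool" where
  "loewner_le X Y \<longleftrightarrow> pos_semidef (Y - X)"

definition chaotic_le :: "'n::finite rmat \<Rightarrow> 'n rmat \<Rightarrow> bool" where
  "chaotic_le X Y \<longleftrightarrow> loewner_le (mlog X) (mlog Y)"

definition gmean :: "'n::finite rmat \<Rightarrow> 'n rmat \<Rightarrow> 'n rmat" where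
  "gmean X Z = mpow X (1/2) ** mpow (mpow X (-1/2) ** Z ** mpow X (-1/2)) (1/2) ** mpow X (1/2)"

definition near_le :: "'n::finite rmat \<Rightarrow> 'n rmat \<Rightarrow> bool" where
  "near_le X Y \<longleftrightarrow> loewner_le (gmean X (matrix_inv Y)) (mat 1)"

definition R_mean :: "real \<Rightarrow> real \<Rightarrow> 'n::finite rmat \<Rightarrow> 'n rmat \<Rightarrow> 'n rmat" where
  "R_mean \<alpha> p A B = mpow (mpow A ((1 - \<alpha>) / 2 * p) ** mpow B (\<alpha> * p) ** mpow A ((1 - \<alpha>) / 2 * p)) (1 / p)"

definition A_mean :: "real \<Rightarrow> real \<Rightarrow> 'n::finite rmat \<Rightarrow> 'n rmat \<Rightarrow> 'n rmat" where
  "A_mean \<alpha> q A B = mpow ((1 - \<alpha>) *\<^sub>R mpow A q + \<alpha> *\<^sub>R mpow B q) (1 / q)"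

end

theory Submission
  imports Defs
begin

text \<open>
  Take \<open>B = diag(x, 1)\<close> and perturb it off the diagonal, \<open>A = B + t J\<close> with \<open>J\<close> the
  exchange matrix. To first order in \<open>t\<close> every matrix function, sandwich product or
  linear combination of such curves is again diagonal plus \<open>t c J\<close>, and only the slope \<open>c\<close>
  matters: a function \<open>f\<close> multiplies it by a divided difference. The slope of the
  power mean is \<open>1 - \<alpha>\<close> for every \<open>q\<close>, while the slope of \<open>R\<close> tends to \<open>1\<close> as \<open>x\<close>
  grows. Once the slopes differ, each of the differences that decide the three orders
  equals a nonzero multiple of \<open>t J\<close> up to \<open>o(t)\<close>, hence is indefinite for small \<open>t\<close>.
\<close>

section \<open>Well-definedness of the functional calculus\<close>

text \<open>Two diagonalizations of one matrix are intertwined by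
  \<open>W = transpose V ** U\<close>. A nonzero entry of \<open>W\<close> links only equal
  eigenvalues, so \<open>W\<close> still intertwines the diagonals after \<open>f\<close> is
  applied.\<close>

lemma mfun_diagonalized:
  fixes U :: "'n::finite rmat"
  assumes U: "orthogonal_matrix U"
  shows "mfun f (U ** diag_mat d ** transpose U) = U ** diag_mat (f \<circ> d) ** transpose U"
  unfolding mfun_def
proof (rule the_equality)
  fix M :: "'n rmat"
  assume "\<exists>V e. orthogonal_matrix V \<and> U ** diag_mat d ** transpose U = V ** diag_mat e ** transpose V
      \<and> M = V ** diag_mat (f \<circ> e) ** transpose V"
  then obtain V e where V: "orthogonal_matrix V"
    and eq: "U ** diag_mat d ** transpose U = V ** diag_mat e ** transpose V"
    and M: "M = V ** diag_mat (f \<circ> e) ** transpose V"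
    by blast
  have oU: "transpose U ** U = mat 1" "U ** transpose U = mat 1"
    and oV: "transpose V ** V = mat 1" "V ** transpose V = mat 1"
    using U V by (auto simp: orthogonal_matrix_def)
  define W where "W = transpose V ** U"
  have comm_entry: "(W ** diag_mat g) $ i $ j = W $ i $ j * g j"
    "(diag_mat g ** W) $ i $ j = g i * W $ i $ j" for g i j
    by (simp_all add: matrix_matrix_mult_def diag_mat_def if_distrib[of "\<lambda>x. _ * x"]
        if_distrib[of "\<lambda>x. x * _"] cong: if_cong)
  have "W ** diag_mat d = transpose V ** (U ** diag_mat d ** transpose U) ** U"
    by (simp add: W_def oU flip: matrix_mul_assoc)
  also have "\<dots> = (transpose V ** V) ** diag_mat e ** W"
    by (simp add: eq W_def matrix_mul_assoc)
  finally have WD: "W ** diag_mat d = diag_mat e ** W"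
    by (simp add: oV)
  have "W $ i $ j * f (d j) = f (e i) * W $ i $ j" for i j
  proof -
    have "W $ i $ j * d j = e i * W $ i $ j"
      by (metis WD comm_entry)
    then show ?thesis
      by (cases "W $ i $ j = 0") auto
  qed
  then have "W ** diag_mat (f \<circ> d) = diag_mat (f \<circ> e) ** W"
    by (simp add: vec_eq_iff comm_entry)
  then have "V ** (W ** diag_mat (f \<circ> d)) ** transpose U
      = V ** (diag_mat (f \<circ> e) ** W) ** transpose U"
    by simp
  moreover have "V ** (W ** X) = U ** X" for X :: "'n rmat"
    by (simp add: W_def matrix_mul_assoc oV)
  moreover have "Y ** W ** transpose U = Y ** transpose V" for Y :: "'n rmat"
    by (simp add: W_def oU flip: matrix_mul_assoc)
  ultimately show "M = U ** diag_mat (f \<circ> d) ** transpose U"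
    by (simp add: M matrix_mul_assoc)
qed (use U in blast)

section \<open>Functional calculus of symmetric 2x2 matrices\<close>

definition sym2 :: "real \<Rightarrow> real \<Rightarrow> real \<Rightarrow> real^2^2" where
  "sym2 a d c = (\<chi> i j. if i = j then if i = 1 then a else d else c)"

lemma sym2_nth [simp]:
  "sym2 a d c $ 1 $ 1 = a" "sym2 a d c $ 2 $ 2 = d"
  "sym2 a d c $ 1 $ 2 = c" "sym2 a d c $ 2 $ 1 = c"
  by (simp_all add: sym2_def)

lemma mat2_eq_iff:
  fixes M N :: "real^2^2"
  shows "M = N \<longleftrightarrow> M$1$1 = N$1$1 \<and> M$1$2 = N$1$2 \<and> M$2$1 = N$2$1 \<and> M$2$2 = N$2$2"
  by (auto simp: vec_eq_iff forall_2)

lemma mat2_mult_nth: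
  fixes M N :: "real^2^2"
  shows "(M ** N) $ i $ j = M$i$1 * N$1$j + M$i$2 * N$2$j"
  by (simp add: matrix_matrix_mult_def sum_2)

text \<open>On the eigenvalues \<open>l\<close>, \<open>m\<close> the function \<open>f\<close>
  agrees with its linear interpolant, which applied to the matrix gives these entries. Fixing only
  trace and determinant leaves the order of \<open>l\<close> and \<open>m\<close> free.\<close>

lemma mfun_sym2:
  assumes tr: "l + m = a + d" and det: "l * m = a * d - c\<^sup>2" and ne: "l \<noteq> m"
  shows "mfun f (sym2 a d c) = sym2 ((a * (f l - f m) + l * f m - m * f l) / (l - m))
     ((d * (f l - f m) + l * f m - m * f l) / (l - m)) (c * (f l - f m) / (l - m))"
proof -
  \<comment> \<open>Squared coordinates of a unit eigenvector for \<open>l\<close>.\<close>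
  define u2 v2 where "u2 = (a - m) / (l - m)" and "v2 = (d - m) / (l - m)"
  have sum: "u2 + v2 = 1"
  proof -
    have "a - m + (d - m) = l - m"
      using tr by simp
    then show ?thesis
      using ne by (simp add: u2_def v2_def flip: add_divide_distrib)
  qed
  have "(a - m) * (d - m) = c\<^sup>2"
  proof -
    have "(a - m) * (d - m) = a * d - m * (a + d) + m * m"
      by algebra
    also have "\<dots> = c\<^sup>2"
      unfolding tr[symmetric] using det by (simp add: algebra_simps)
    finally show ?thesis .
  qed
  then have prod: "u2 * v2 = (c / (l - m))\<^sup>2"
    by (simp add: u2_def v2_def power2_eq_square)
  have nonneg: "0 \<le> u2" "0 \<le> v2"
  proof -
    have "0 \<le> u2 * v2"
      unfolding prod by simp
    then show "0 \<le> u2" "0 \<le> v2"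
      using sum by (auto simp: zero_le_mult_iff)
  qed
  \<comment> \<open>The product \<open>u2 * v2\<close> fixes \<open>u * v\<close> only up to sign;
    the sign put into \<open>v\<close> makes it \<open>c / (l - m)\<close>, as the off-diagonal
    entry requires.\<close>
  define u v where "u = sqrt u2" and "v = (if c / (l - m) < 0 then - 1 else 1) * sqrt v2"
  have uu: "u * u = u2" and vv: "v * v = v2"
    using nonneg by (auto simp: u_def v_def)
  have uv: "u * v = c / (l - m)"
  proof -
    have "u * v = (if c / (l - m) < 0 then - 1 else 1) * sqrt (u2 * v2)"
      by (simp add: u_def v_def real_sqrt_mult)
    also have "\<dots> = (if c / (l - m) < 0 then - 1 else 1) * \<bar>c / (l - m)\<bar>"
      unfolding prod real_sqrt_abs ..
    finally show ?thesis
      by (auto simp only: abs_if split: if_splits)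
  qed
  define U :: "real^2^2" where
    "U = (\<chi> i j. if i = j then u else if i = 1 then - v else v)"
  have U_nth: "U$1$1 = u" "U$1$2 = - v" "U$2$1 = v" "U$2$2 = u"
    by (simp_all add: U_def)
  have orth: "orthogonal_matrix U"
    using sum uu vv
    by (auto simp: orthogonal_matrix mat2_eq_iff mat2_mult_nth transpose_def U_nth mat_def)
  have conj: "U ** diag_mat (\<lambda>i. if i = 1 then g l else g m) ** transpose U
      = sym2 ((a * (g l - g m) + l * g m - m * g l) / (l - m))
     ((d * (g l - g m) + l * g m - m * g l) / (l - m)) (c * (g l - g m) / (l - m))" for g
  proof -
    have "U ** diag_mat (\<lambda>i. if i = 1 then g l else g m) ** transpose U
      = sym2 (g l * (u * u) + g m * (v * v)) (g l * (v * v) + g m * (u * u)) ((u * v) * (g l - g m))"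
      by (auto simp: mat2_eq_iff mat2_mult_nth transpose_def U_nth diag_mat_def algebra_simps)
    moreover have "g l * u2 + g m * v2 = (a * (g l - g m) + l * g m - m * g l) / (l - m)"
    proof -
      have d: "d - m = l - a" using tr by simp
      show ?thesis
        unfolding u2_def v2_def d using ne by (simp add: divide_simps) (simp add: algebra_simps)
    qed
    moreover have "g l * v2 + g m * u2 = (d * (g l - g m) + l * g m - m * g l) / (l - m)"
    proof -
      have a: "a - m = l - d" using tr by simp
      show ?thesis
        unfolding u2_def v2_def a using ne by (simp add: divide_simps) (simp add: algebra_simps)
    qed
    ultimately show ?thesis
      by (simp add: uu vv uv)
  qed
  \<comment> \<open>The case of the identity function shows that \<open>U\<close> diagonalizes the
    given matrix.\<close>
  have "sym2 a d c = U ** diag_mat (\<lambda>i. if i = 1 then l else m) ** transpose U"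
    using ne by (simp add: conj[of "\<lambda>x. x"] mat2_eq_iff)
  then have "mfun f (sym2 a d c) = U ** diag_mat (f \<circ> (\<lambda>i. if i = 1 then l else m)) ** transpose U"
    using mfun_diagonalized[OF orth] by simp
  also have "f \<circ> (\<lambda>i::2. if i = 1 then l else m) = (\<lambda>i. if i = 1 then f l else f m)"
    by auto
  finally show ?thesis
    by (simp add: conj)
qed

section \<open>First-order calculus of symmetric matrix curves\<close>

text \<open>\<open>tangent M x y c\<close>: to first order in \<open>t\<close>, \<open>M t\<close> is the diagonal matrix
  with entries \<open>x\<close>, \<open>y\<close> plus \<open>t\<close> times a purely off-diagonal perturbation.\<close>
definition tangent :: "(real \<Rightarrow> real^2^2) \<Rightarrow> real \<Rightarrow> real \<Rightarrow> real \<Rightarrow> bool" where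
  "tangent M x y c \<longleftrightarrow> (\<exists>a d o'. (\<forall>\<^sub>F t in nhds 0. M t = sym2 (a t) (d t) (o' t))
     \<and> a 0 = x \<and> d 0 = y \<and> o' 0 = 0
     \<and> (a has_real_derivative 0) (at 0) \<and> (d has_real_derivative 0) (at 0)
     \<and> (o' has_real_derivative c) (at 0))"

lemma tangentI:
  assumes "\<forall>\<^sub>F t in nhds 0. M t = sym2 (a t) (d t) (o' t)"
    and "a 0 = x" "d 0 = y" "o' 0 = 0"
    and "(a has_real_derivative 0) (at 0)" "(d has_real_derivative 0) (at 0)"
    and "(o' has_real_derivative c) (at 0)"
  shows "tangent M x y c"
  unfolding tangent_def using assms by blast

lemma tangentE:
  assumes "tangent M x y c"
  obtains a d o' where "\<forall>\<^sub>F t in nhds 0. M t = sym2 (a t) (d t) (o' t)"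
    "a 0 = x" "d 0 = y" "o' 0 = 0"
    "(a has_real_derivative 0) (at 0)" "(d has_real_derivative 0) (at 0)"
    "(o' has_real_derivative c) (at 0)"
  using assms unfolding tangent_def by blast

lemma tangent_cong:
  "tangent M x y c \<Longrightarrow> x = x' \<Longrightarrow> y = y' \<Longrightarrow> c = c' \<Longrightarrow> tangent M x' y' c'"
  by simp

text \<open>The off-diagonal entry enters the eigenvalues only through its square, so they and their
  images under \<open>f\<close> have zero derivative at 0. In the closed form of
  \<open>mfun_sym2\<close> only the factor \<open>o' t\<close> then varies to first order.\<close>

lemma tangent_mfun:
  assumes M: "tangent M x y c" and ne: "x \<noteq> y"
    and f: "(f has_real_derivative f1) (at x)" "(f has_real_derivative f2) (at y)"
  shows "tangent (\<lambda>t. mfun f (M t)) (f x) (f y) (c * (f x - f y) / (x - y))"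
proof -
  obtain a d o' where ev: "\<forall>\<^sub>F t in nhds 0. M t = sym2 (a t) (d t) (o' t)"
    and v: "a 0 = x" "d 0 = y" "o' 0 = 0"
    and D: "(a has_real_derivative 0) (at 0)" "(d has_real_derivative 0) (at 0)"
      "(o' has_real_derivative c) (at 0)"
    by (rule tangentE[OF M])
  \<comment> \<open>The sign makes \<open>l\<close> the eigenvalue branch through \<open>x\<close> whichever of \<open>x\<close>, \<open>y\<close> is larger.\<close>
  define h where "h t = sgn (x - y) * sqrt (((a t - d t) / 2)\<^sup>2 + (o' t)\<^sup>2)" for t
  define l where "l t = (a t + d t) / 2 + h t" for t
  define m where "m t = (a t + d t) / 2 - h t" for t
  have h0: "h 0 = (x - y) / 2"
    by (simp add: h_def v real_sqrt_abs sgn_mult_abs abs_divide)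
  \<comment> \<open>Since \<open>x\<close> and \<open>y\<close> differ, the radicand in
    \<open>h\<close> is positive at 0 and the root is differentiable there.\<close>
  have sq: "((x - y) / 2)\<^sup>2 > 0"
    using ne by simp
  have Dh: "(h has_real_derivative 0) (at 0)"
    unfolding h_def using sq by (auto intro!: derivative_eq_intros D simp: v)
  have lm0: "l 0 = x" "m 0 = y"
    by (simp_all add: l_def m_def h0 v field_simps)
  have Dl: "(l has_real_derivative 0) (at 0)" and Dm: "(m has_real_derivative 0) (at 0)"
    unfolding l_def m_def by (auto intro!: derivative_eq_intros D Dh)
  have Dfl: "((\<lambda>t. f (l t)) has_real_derivative 0) (at 0)"
    using DERIV_chain2[of f f1 l 0 0] f Dl by (simp add: lm0)
  have Dfm: "((\<lambda>t. f (m t)) has_real_derivative 0) (at 0)"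
    using DERIV_chain2[of f f2 m 0 0] f Dm by (simp add: lm0)
  have "isCont (\<lambda>t. l t - m t) 0"
    using DERIV_isCont[OF Dl] DERIV_isCont[OF Dm] by (intro continuous_intros)
  then have "((\<lambda>t. l t - m t) \<longlongrightarrow> x - y) (nhds 0)"
    using tendsto_at_iff_tendsto_nhds[of "\<lambda>t. l t - m t" 0] by (simp add: isCont_def lm0)
  then have evne: "\<forall>\<^sub>F t in nhds 0. l t - m t \<noteq> 0"
    by (rule tendsto_imp_eventually_ne) (use ne in simp)
  have eq: "\<forall>\<^sub>F t in nhds 0. mfun f (M t) =
      sym2 ((a t * (f (l t) - f (m t)) + l t * f (m t) - m t * f (l t)) / (l t - m t))
     ((d t * (f (l t) - f (m t)) + l t * f (m t) - m t * f (l t)) / (l t - m t))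
     (o' t * (f (l t) - f (m t)) / (l t - m t))"
    using ev evne
  proof eventually_elim
    case (elim t)
    have "(h t)\<^sup>2 = ((a t - d t) / 2)\<^sup>2 + (o' t)\<^sup>2"
      using ne by (simp add: h_def power_mult_distrib sgn_if)
    then have "l t * m t = a t * d t - (o' t)\<^sup>2"
      unfolding l_def m_def by (simp add: power2_eq_square field_simps)
    moreover have "l t + m t = a t + d t"
      by (simp add: l_def m_def)
    ultimately show ?case
      using elim by (simp add: mfun_sym2)
  qed
  show ?thesis
  proof (rule tangentI[OF eq], goal_cases)
    case 1
    show ?case using ne by (simp add: v lm0 field_simps)
  next
    case 2
    show ?case using ne by (simp add: v lm0 field_simps)
  next
    case 3
    show ?case by (simp add: v)
  next
    case 4
    show ?case using ne by (auto intro!: derivative_eq_intros D Dl Dm Dfl Dfm simp: lm0)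
  next
    case 5
    show ?case using ne by (auto intro!: derivative_eq_intros D Dl Dm Dfl Dfm simp: lm0)
  next
    case 6
    show ?case using ne
      by (auto intro!: derivative_eq_intros D Dl Dm Dfl Dfm simp: lm0 v)
  qed
qed

lemma tangent_mpow:
  assumes "tangent M x y c" "x \<noteq> y" "0 < x" "0 < y"
  shows "tangent (\<lambda>t. mpow (M t) s) (x powr s) (y powr s) (c * (x powr s - y powr s) / (x - y))"
  unfolding mpow_def
  by (rule tangent_mfun[where ?f1.0 = "s * x powr (s - 1)" and ?f2.0 = "s * y powr (s - 1)"])
    (use assms in \<open>auto intro!: derivative_eq_intros\<close>)

text \<open>Every term of a diagonal entry has an even number of off-diagonal factors, hence zero
  derivative. The slope comes from the terms of the off-diagonal entry with exactly one such
  factor.\<close>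

lemma tangent_sandwich:
  assumes S: "tangent S s1 s2 c" and T: "tangent T t1 t2 e"
  shows "tangent (\<lambda>t. S t ** T t ** S t) (s1 * t1 * s1) (s2 * t2 * s2)
     (c * (s1 * t1 + s2 * t2) + s1 * s2 * e)"
proof -
  obtain a d o' where S': "\<forall>\<^sub>F t in nhds 0. S t = sym2 (a t) (d t) (o' t)"
    "a 0 = s1" "d 0 = s2" "o' 0 = 0"
    "(a has_real_derivative 0) (at 0)" "(d has_real_derivative 0) (at 0)"
    "(o' has_real_derivative c) (at 0)"
    by (rule tangentE[OF S])
  obtain a2 d2 o2 where T': "\<forall>\<^sub>F t in nhds 0. T t = sym2 (a2 t) (d2 t) (o2 t)"
    "a2 0 = t1" "d2 0 = t2" "o2 0 = 0"
    "(a2 has_real_derivative 0) (at 0)" "(d2 has_real_derivative 0) (at 0)"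
    "(o2 has_real_derivative e) (at 0)"
    by (rule tangentE[OF T])
  have "\<forall>\<^sub>F t in nhds 0. S t ** T t ** S t = sym2
     (a t * a2 t * a t + 2 * a t * o2 t * o' t + o' t * d2 t * o' t)
     (o' t * a2 t * o' t + 2 * o' t * o2 t * d t + d t * d2 t * d t)
     (a t * a2 t * o' t + a t * o2 t * d t + o' t * o2 t * o' t + o' t * d2 t * d t)"
    using S'(1) T'(1)
    by eventually_elim (auto simp: mat2_eq_iff mat2_mult_nth algebra_simps)
  then show ?thesis
    by (rule tangentI)
      (auto intro!: derivative_eq_intros S' T' simp: S' T' algebra_simps)
qed

lemma matrix_inv_eqI:
  fixes A B :: "real^'n^'n"
  assumes "A ** B = mat 1" "B ** A = mat 1"
  shows "matrix_inv A = B"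
proof -
  have "A ** matrix_inv A = mat 1 \<and> matrix_inv A ** A = mat 1"
    unfolding matrix_inv_def by (rule someI[of _ B]) (use assms in blast)
  then show ?thesis
    by (metis assms(2) matrix_mul_assoc matrix_mul_lid matrix_mul_rid)
qed

text \<open>The inverse is adjugate over determinant, and the determinant has value
  \<open>x * y\<close> and zero derivative at 0.\<close>

lemma tangent_matrix_inv:
  assumes Y: "tangent Y x y c" and nz: "x \<noteq> 0" "y \<noteq> 0"
  shows "tangent (\<lambda>t. matrix_inv (Y t)) (1 / x) (1 / y) (- c / (x * y))"
proof -
  obtain a d o' where Y': "\<forall>\<^sub>F t in nhds 0. Y t = sym2 (a t) (d t) (o' t)"
    "a 0 = x" "d 0 = y" "o' 0 = 0"
    "(a has_real_derivative 0) (at 0)" "(d has_real_derivative 0) (at 0)"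
    "(o' has_real_derivative c) (at 0)"
    by (rule tangentE[OF Y])
  define D where "D t = a t * d t - o' t * o' t" for t
  have D0: "D 0 = x * y"
    by (simp add: D_def Y')
  have DD: "(D has_real_derivative 0) (at 0)"
    unfolding D_def by (auto intro!: derivative_eq_intros Y' simp: Y')
  have "(D \<longlongrightarrow> x * y) (nhds 0)"
    using DERIV_isCont[OF DD] tendsto_at_iff_tendsto_nhds[of D 0] by (simp add: isCont_def D0)
  then have "\<forall>\<^sub>F t in nhds 0. D t \<noteq> 0"
    by (rule tendsto_imp_eventually_ne) (use nz in simp)
  with Y'(1) have "\<forall>\<^sub>F t in nhds 0. matrix_inv (Y t) = sym2 (d t / D t) (a t / D t) (- o' t / D t)"
  proof eventually_elim
    case (elim t)
    have "a t * d t - o' t * o' t = D t"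
      by (simp add: D_def)
    then have "Y t ** sym2 (d t / D t) (a t / D t) (- o' t / D t) = mat 1"
      "sym2 (d t / D t) (a t / D t) (- o' t / D t) ** Y t = mat 1"
      using elim
      by (auto simp: mat2_eq_iff mat2_mult_nth mat_def mult.commute simp flip: diff_divide_distrib)
    then show ?case
      by (rule matrix_inv_eqI)
  qed
  then show ?thesis
    by (rule tangentI) (use nz in \<open>auto intro!: derivative_eq_intros Y' DD simp: Y' D0\<close>)
qed

lemma tangent_lincomb:
  assumes S: "tangent S s1 s2 c" and T: "tangent T t1 t2 e"
  shows "tangent (\<lambda>t. k *\<^sub>R S t + k' *\<^sub>R T t) (k * s1 + k' * t1) (k * s2 + k' * t2) (k * c + k' * e)"
proof -
  obtain a d o' where S': "\<forall>\<^sub>F t in nhds 0. S t = sym2 (a t) (d t) (o' t)"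
    "a 0 = s1" "d 0 = s2" "o' 0 = 0"
    "(a has_real_derivative 0) (at 0)" "(d has_real_derivative 0) (at 0)"
    "(o' has_real_derivative c) (at 0)"
    by (rule tangentE[OF S])
  obtain a2 d2 o2 where T': "\<forall>\<^sub>F t in nhds 0. T t = sym2 (a2 t) (d2 t) (o2 t)"
    "a2 0 = t1" "d2 0 = t2" "o2 0 = 0"
    "(a2 has_real_derivative 0) (at 0)" "(d2 has_real_derivative 0) (at 0)"
    "(o2 has_real_derivative e) (at 0)"
    by (rule tangentE[OF T])
  have "\<forall>\<^sub>F t in nhds 0. k *\<^sub>R S t + k' *\<^sub>R T t = sym2
     (k * a t + k' * a2 t) (k * d t + k' * d2 t) (k * o' t + k' * o2 t)"
    using S'(1) T'(1) by eventually_elim (auto simp: mat2_eq_iff)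
  then show ?thesis
    by (rule tangentI) (auto intro!: derivative_eq_intros S' T' simp: S' T')
qed

lemma tangent_sym2_const: "tangent (\<lambda>t. sym2 x y 0) x y 0"
  by (rule tangentI[of _ "\<lambda>_. x" "\<lambda>_. y" "\<lambda>_. 0"]) auto

lemma tangent_sym2: "tangent (sym2 x y) x y 1"
  by (rule tangentI[of _ "\<lambda>_. x" "\<lambda>_. y" "\<lambda>t. t"]) auto

section \<open>Failure of the three orders\<close>

text \<open>The test vectors (1, 1) and (1, -1) give the bound for both signs of
  \<open>c\<close>.\<close>

lemma pos_semidef_sym2_offdiag:
  assumes "pos_semidef (sym2 a d c)"
  shows "2 * \<bar>c\<bar> \<le> a + d"
proof -
  have "0 \<le> v \<bullet> (sym2 a d c *v v)" for v
    using assms by (simp add: pos_semidef_def)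
  from this[of "vector [1, 1]"] this[of "vector [1, - 1]"] show ?thesis
    by (simp add: inner_vec_def matrix_vector_mult_def sum_2)
qed

text \<open>The difference has diagonal \<open>o(t)\<close> but off-diagonal entry
  \<open>(e - c) t + o(t)\<close>, which for small positive \<open>t\<close> violates
  \<open>pos_semidef_sym2_offdiag\<close>.\<close>

lemma tangent_not_loewner:
  assumes X: "tangent X x y c" and Y: "tangent Y x y e" and ne: "c \<noteq> e"
  shows "\<forall>\<^sub>F t in at_right 0. \<not> loewner_le (X t) (Y t)"
proof -
  have "tangent (\<lambda>t. Y t - X t) 0 0 (e - c)"
    using tangent_lincomb[OF Y X, of 1 "- 1"] by simp
  then obtain a d o' where D: "\<forall>\<^sub>F t in nhds 0. Y t - X t = sym2 (a t) (d t) (o' t)"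
    "a 0 = 0" "d 0 = 0" "o' 0 = 0"
    "(a has_real_derivative 0) (at 0)" "(d has_real_derivative 0) (at 0)"
    "(o' has_real_derivative (e - c)) (at 0)"
    by (rule tangentE)
  \<comment> \<open>The sign factor merges the two cases of \<open>e - c\<close>: \<open>g\<close>
    starts at 0 with slope \<open>-2 |e - c|\<close>, so it is negative just to the right of
    0.\<close>
  define g where "g t = a t + d t - 2 * sgn (e - c) * o' t" for t
  have "(g has_real_derivative (- 2 * \<bar>e - c\<bar>)) (at 0)"
    unfolding g_def by (auto intro!: derivative_eq_intros D simp: abs_sgn)
  moreover have "- 2 * \<bar>e - c\<bar> < 0"
    using ne by simp
  ultimately obtain r where r: "0 < r" "\<And>t. 0 < t \<Longrightarrow> t < r \<Longrightarrow> g t < g 0"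
    using DERIV_neg_dec_right[of g "- 2 * \<bar>e - c\<bar>" 0] by (metis add_0)
  have "\<forall>\<^sub>F t in at_right 0. t < r"
    using r(1) by (intro eventually_at_right_field[THEN iffD2]) auto
  moreover have "\<forall>\<^sub>F t in at_right (0::real). 0 < t"
    by (simp add: eventually_at_right_less)
  moreover have "\<forall>\<^sub>F t in at_right 0. Y t - X t = sym2 (a t) (d t) (o' t)"
    using D(1) by (simp add: eventually_at_filter eventually_mono)
  ultimately show ?thesis
  proof eventually_elim
    case (elim t)
    have "g t < 0"
      using r(2)[of t] elim by (simp add: g_def D)
    moreover have "sgn (e - c) * o' t \<le> \<bar>o' t\<bar>"
      using ne by (auto simp: sgn_if)
    ultimately have "a t + d t < 2 * \<bar>o' t\<bar>"
      by (simp add: g_def)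
    then show ?case
      using pos_semidef_sym2_offdiag[of "a t" "d t" "o' t"] elim by (auto simp: loewner_le_def)
  qed
qed

text \<open>Logarithms keep the diagonals equal and multiply both slopes by the same nonzero divided
  difference of \<open>ln\<close>.\<close>

lemma tangent_not_chaotic:
  assumes X: "tangent X x y c" and Y: "tangent Y x y e" and ne: "c \<noteq> e"
    and pos: "0 < x" "0 < y" "x \<noteq> y"
  shows "\<forall>\<^sub>F t in at_right 0. \<not> chaotic_le (X t) (Y t)"
proof -
  have "tangent (\<lambda>t. mlog (M t)) (ln x) (ln y) (k * (ln x - ln y) / (x - y))"
    if "tangent M x y k" for M k
    unfolding mlog_def
    by (rule tangent_mfun[OF that, where ?f1.0 = "1 / x" and ?f2.0 = "1 / y"])
      (use pos in \<open>auto intro!: derivative_eq_intros\<close>)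
  from tangent_not_loewner[OF this[OF X] this[OF Y]] show ?thesis
    unfolding chaotic_le_def using ne pos by simp
qed

text \<open>Normalizing the diagonal to \<open>w\<^sup>2\<close> and 1 makes all square roots
  rational in \<open>w\<close>. The slope vanishes for \<open>c = e\<close>, in line with the
  geometric mean of a matrix and its inverse being the identity.\<close>

lemma tangent_gmean_inv:
  assumes X: "tangent X (w\<^sup>2) 1 c" and Y: "tangent Y (w\<^sup>2) 1 e" and w: "1 < w"
  shows "tangent (\<lambda>t. gmean (X t) (matrix_inv (Y t))) 1 1 ((c - e) / (1 + w\<^sup>2))"
proof -
  have w2: "w\<^sup>2 \<noteq> 1" "0 < w\<^sup>2" "w\<^sup>2 - 1 = (w - 1) * (w + 1)" "w \<noteq> 0" "w - 1 \<noteq> 0" "w + 1 \<noteq> 0"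
    using w by (auto simp: power2_eq_1_iff) (simp add: power2_eq_square algebra_simps)
  have half: "(w\<^sup>2) powr (1/2) = w"
    using w by (simp add: powr_half_sqrt)
  have mhalf: "(w\<^sup>2) powr (-1/2) = 1 / w"
  proof -
    \<comment> \<open>The numeral \<open>-1/2\<close> is read as \<open>(- 1) / 2\<close>, while
      \<open>powr_minus_divide\<close> expects a negated exponent.\<close>
    have "- 1 / 2 = - (1 / 2 :: real)"
      by simp
    then show ?thesis
      by (simp only: powr_minus_divide half)
  qed
  have S: "tangent (\<lambda>t. mpow (X t) (1/2)) w 1 (c / (w + 1))"
  proof (rule tangent_cong[OF tangent_mpow[OF X, of "1/2"]])
    show "c * ((w\<^sup>2) powr (1/2) - 1 powr (1/2)) / (w\<^sup>2 - 1) = c / (w + 1)"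
      unfolding half w2(3) using w2(5,6) by simp
  qed (use w2 half in auto)
  have S': "tangent (\<lambda>t. mpow (X t) (-1/2)) (1 / w) 1 (- c / (w * (w + 1)))"
  proof (rule tangent_cong[OF tangent_mpow[OF X, of "-1/2"]])
    show "c * ((w\<^sup>2) powr (-1/2) - 1 powr (-1/2)) / (w\<^sup>2 - 1) = - c / (w * (w + 1))"
      unfolding mhalf w2(3) using w2(4-6) by (simp add: divide_simps) (simp add: algebra_simps)
  qed (use w2 mhalf in auto)
  have T: "tangent (\<lambda>t. mpow (X t) (-1/2) ** matrix_inv (Y t) ** mpow (X t) (-1/2))
     ((1 / w\<^sup>2)\<^sup>2) 1 (- (c * (w\<^sup>2 - w + 1) + e * w) / w^4)"
  proof (rule tangent_cong[OF tangent_sandwich[OF S' tangent_matrix_inv[OF Y]]])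
    \<comment> \<open>Factoring the sum of cubes \<open>w^3 + 1\<close> exposes
      \<open>w + 1\<close>, which cancels against the denominator in \<open>S'\<close>.\<close>
    have "1 / w * (1 / w\<^sup>2) + 1 * (1 / 1) = (w + 1) * (w\<^sup>2 - w + 1) / w^3"
      using w2(4) by (simp add: power2_eq_square power3_eq_cube divide_simps)
        (simp add: algebra_simps)
    then have "- c / (w * (w + 1)) * (1 / w * (1 / w\<^sup>2) + 1 * (1 / 1))
        = - (c * (w\<^sup>2 - w + 1)) / w^4"
      using w2(6) by (simp add: power3_eq_cube power4_eq_xxxx)
    moreover have "1 / w * 1 * (- e / (w\<^sup>2 * 1)) = - (e * w) / w^4"
      using w2(4) by (simp add: power2_eq_square power4_eq_xxxx)
    ultimately show "- c / (w * (w + 1)) * (1 / w * (1 / w\<^sup>2) + 1 * (1 / 1))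
        + 1 / w * 1 * (- e / (w\<^sup>2 * 1)) = - (c * (w\<^sup>2 - w + 1) + e * w) / w^4"
      by (simp add: add_divide_distrib diff_divide_distrib)
  qed (use w2 in \<open>auto simp: power2_eq_square\<close>)
  have quarter: "((1 / w\<^sup>2)\<^sup>2) powr (1/2) = 1 / w\<^sup>2"
    using w by (simp add: powr_half_sqrt)
  have ne: "(1 / w\<^sup>2)\<^sup>2 \<noteq> 1" "1 / w\<^sup>2 - 1 \<noteq> 0" "1 / w\<^sup>2 + 1 > 0"
  proof -
    have "1 < w\<^sup>2"
      using w by simp
    then have z: "0 < 1 / w\<^sup>2" "1 / w\<^sup>2 < 1"
      using w2(2) by (simp_all only: zero_less_divide_1_iff divide_less_eq_1_pos)
    then show "(1 / w\<^sup>2)\<^sup>2 \<noteq> 1" "1 / w\<^sup>2 - 1 \<noteq> 0" "1 / w\<^sup>2 + 1 > 0"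
      by (auto simp only: power2_eq_1_iff)
  qed
  \<comment> \<open>The factor \<open>1 / w\<^sup>2 - 1\<close> is also the numerator of the divided
    difference of the square root and cancels.\<close>
  have fac: "(1 / w\<^sup>2)\<^sup>2 - 1 = (1 / w\<^sup>2 - 1) * (1 / w\<^sup>2 + 1)"
    by (simp add: power2_eq_square algebra_simps)
  have T': "tangent (\<lambda>t. mpow (mpow (X t) (-1/2) ** matrix_inv (Y t) ** mpow (X t) (-1/2)) (1/2))
     (1 / w\<^sup>2) 1 (- (c * (w\<^sup>2 - w + 1) + e * w) / (w\<^sup>2 * (1 + w\<^sup>2)))"
  proof (rule tangent_cong[OF tangent_mpow[OF T, of "1/2"]])
    have "- (c * (w\<^sup>2 - w + 1) + e * w) / w ^ 4 * (((1 / w\<^sup>2)\<^sup>2) powr (1/2) - 1 powr (1/2)) / ((1 / w\<^sup>2)\<^sup>2 - 1)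
      = - (c * (w\<^sup>2 - w + 1) + e * w) / w ^ 4 / (1 / w\<^sup>2 + 1)"
      unfolding quarter fac powr_one_eq_one
      by (subst times_divide_eq_right[symmetric], subst nonzero_divide_mult_cancel_left[OF ne(2)]) simp
    also have "\<dots> = - (c * (w\<^sup>2 - w + 1) + e * w) / (w\<^sup>2 * (1 + w\<^sup>2))"
    proof -
      have "w ^ 4 * (1 / w\<^sup>2 + 1) = w\<^sup>2 * (1 + w\<^sup>2)"
        using w2(4) by (simp add: field_simps power2_eq_square power4_eq_xxxx)
      then show ?thesis
        by (simp add: divide_divide_eq_left)
    qed
    finally show "- (c * (w\<^sup>2 - w + 1) + e * w) / w ^ 4 * (((1 / w\<^sup>2)\<^sup>2) powr (1/2) - 1 powr (1/2)) / ((1 / w\<^sup>2)\<^sup>2 - 1)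
      = - (c * (w\<^sup>2 - w + 1) + e * w) / (w\<^sup>2 * (1 + w\<^sup>2))" .
  qed (use w2 ne quarter in auto)
  have pos: "1 + w\<^sup>2 \<noteq> 0"
    using add_pos_pos[OF zero_less_one w2(2)] by (rule less_imp_neq[symmetric])
  show ?thesis
    unfolding gmean_def
  proof (rule tangent_cong[OF tangent_sandwich[OF S T']])
    have "c / (w + 1) * (w * (1 / w\<^sup>2) + 1 * 1) = c / w"
      using w2 by (simp add: divide_simps power2_eq_square)
    moreover have "w * 1 * (- (c * (w\<^sup>2 - w + 1) + e * w) / (w\<^sup>2 * (1 + w\<^sup>2)))
      = - (c * (w\<^sup>2 - w + 1) + e * w) / (w * (1 + w\<^sup>2))"
      using w2(4) by (simp add: power2_eq_square)
    \<comment> \<open>Over the common denominator the numerator is \<open>c * (1 + w\<^sup>2) - c *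
      (w\<^sup>2 - w + 1) - e * w = (c - e) * w\<close>.\<close>
    moreover have "c / w + - (c * (w\<^sup>2 - w + 1) + e * w) / (w * (1 + w\<^sup>2)) = (c - e) / (1 + w\<^sup>2)"
      using w2(4) pos by (simp add: divide_simps) (simp add: algebra_simps)
    ultimately show "c / (w + 1) * (w * (1 / w\<^sup>2) + 1 * 1)
        + w * 1 * (- (c * (w\<^sup>2 - w + 1) + e * w) / (w\<^sup>2 * (1 + w\<^sup>2))) = (c - e) / (1 + w\<^sup>2)"
      by simp
  qed (use w2 in \<open>auto simp: power2_eq_square\<close>)
qed

text \<open>The geometric mean passes through the identity with nonzero slope, while the constant
  identity has slope 0; \<open>tangent_not_loewner\<close> separates them.\<close>

lemma tangent_not_near:
  assumes X: "tangent X (w\<^sup>2) 1 c" and Y: "tangent Y (w\<^sup>2) 1 e" and w: "1 < w" and ne: "c \<noteq> e"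
  shows "\<forall>\<^sub>F t in at_right 0. \<not> near_le (X t) (Y t)"
proof -
  have "mat 1 = sym2 1 1 0"
    by (simp add: mat2_eq_iff mat_def)
  moreover have "(c - e) / (1 + w\<^sup>2) \<noteq> 0"
    using ne by (simp add: add_nonneg_eq_0_iff)
  ultimately show ?thesis
    using tangent_not_loewner[OF tangent_gmean_inv[OF X Y w] tangent_sym2_const]
    unfolding near_le_def by simp
qed

section \<open>Positivity and the slopes of the two means\<close>

text \<open>Completing the square: \<open>x\<close> times the quadratic form at
  \<open>(a, b)\<close> is
  \<open>(x * a + c * b)\<^sup>2 + (x * y - c\<^sup>2) * b\<^sup>2\<close>.\<close>

lemma pos_def_sym2:
  assumes "0 < x" "c\<^sup>2 < x * y"
  shows "pos_def (sym2 x y c)"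
proof -
  have "v \<bullet> (sym2 x y c *v v) > 0" if "v \<noteq> 0" for v
  proof -
    define a b where "a = v $ 1" and "b = v $ 2"
    have "a \<noteq> 0 \<or> b \<noteq> 0"
      using that by (auto simp: a_def b_def vec_eq_iff forall_2)
    then have "0 < (x * a + c * b)\<^sup>2 + (x * y - c\<^sup>2) * b\<^sup>2"
      using assms by (cases "b = 0") (auto intro!: add_nonneg_pos)
    also have "\<dots> = x * (v \<bullet> (sym2 x y c *v v))"
      by (simp add: inner_vec_def matrix_vector_mult_def sum_2 a_def b_def
          power2_eq_square algebra_simps)
    finally show ?thesis
      using assms by (simp add: zero_less_mult_iff)
  qed
  then show ?thesis
    by (simp add: pos_def_def sym_mat_def mat2_eq_iff transpose_def)
qed

text \<open>Only the two outer factors contribute, as \<open>B\<close> has slope 0. The inner power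
  of \<open>A\<close> divides by \<open>x - y\<close> and the outer power \<open>1 / p\<close>
  multiplies by it, so this factor cancels.\<close>

lemma tangent_R_mean:
  assumes A: "tangent A x y 1" and B: "tangent B x y 0"
    and pos: "0 < x" "0 < y" "x \<noteq> y" "0 < p"
  shows "tangent (\<lambda>t. R_mean \<alpha> p (A t) (B t)) x y
    ((x powr ((1-\<alpha>)/2*p) - y powr ((1-\<alpha>)/2*p)) * (x powr ((1+\<alpha>)/2*p) + y powr ((1+\<alpha>)/2*p))
      / (x powr p - y powr p))"
proof -
  let ?s = "(1 - \<alpha>) / 2 * p"
  have "?s + \<alpha> * p = (1+\<alpha>)/2*p" "?s + \<alpha> * p + ?s = p"
    by (simp_all add: field_simps)
  then have add: "u powr ?s * u powr (\<alpha> * p) = u powr ((1+\<alpha>)/2*p)"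
    "u powr ?s * u powr (\<alpha> * p) * u powr ?s = u powr p" for u
    by (metis powr_add)+
  have inv: "(u powr p) powr (1 / p) = u" if "0 < u" for u
    using that pos by (simp add: powr_powr)
  have ne: "x powr p \<noteq> y powr p"
    using inv pos by metis
  have T: "tangent (\<lambda>t. mpow (A t) ?s ** mpow (B t) (\<alpha> * p) ** mpow (A t) ?s) (x powr p) (y powr p)
    ((x powr ?s - y powr ?s) / (x - y) * (x powr ((1+\<alpha>)/2*p) + y powr ((1+\<alpha>)/2*p)))"
    by (rule tangent_cong[OF tangent_sandwich[OF tangent_mpow[OF A] tangent_mpow[OF B]]])
      (use pos add in simp_all)
  show ?thesis
    unfolding R_mean_def
    by (rule tangent_cong[OF tangent_mpow[OF T ne]]) (use pos inv in simp_all)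
qed

text \<open>The powers \<open>q\<close> and \<open>1 / q\<close> contribute reciprocal divided
  differences, so only the weight of \<open>A\<close> remains.\<close>

lemma tangent_A_mean:
  assumes A: "tangent A x y 1" and B: "tangent B x y 0"
    and pos: "0 < x" "0 < y" "x \<noteq> y" "0 < q"
  shows "tangent (\<lambda>t. A_mean \<alpha> q (A t) (B t)) x y (1 - \<alpha>)"
proof -
  have inv: "(u powr q) powr (1 / q) = u" if "0 < u" for u
    using that pos by (simp add: powr_powr)
  have ne: "x powr q \<noteq> y powr q"
    using inv pos by metis
  have T: "tangent (\<lambda>t. (1 - \<alpha>) *\<^sub>R mpow (A t) q + \<alpha> *\<^sub>R mpow (B t) q) (x powr q) (y powr q)
    ((1 - \<alpha>) * (x powr q - y powr q) / (x - y))"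
    by (rule tangent_cong[OF tangent_lincomb[OF tangent_mpow[OF A] tangent_mpow[OF B]]])
      (use pos in \<open>simp_all add: algebra_simps\<close>)
  show ?thesis
    unfolding A_mean_def
    by (rule tangent_cong[OF tangent_mpow[OF T ne]]) (use pos inv ne in simp_all)
qed

text \<open>Dividing numerator and denominator by \<open>x powr (k + m)\<close> leaves constants and
  negative powers of \<open>x\<close>, which tend to 0.\<close>

lemma R_mean_slope_tendsto:
  assumes "0 < k" "0 < m"
  shows "((\<lambda>x::real. (x powr k - 1) * (x powr m + 1) / (x powr (k + m) - 1)) \<longlongrightarrow> 1) at_top"
proof -
  have neg: "((\<lambda>x::real. x powr - s) \<longlongrightarrow> 0) at_top" if "0 < s" for s
    using that by (intro tendsto_neg_powr filterlim_ident) auto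
  have "((\<lambda>x::real. (1 - x powr - k) * (1 + x powr - m) / (1 - x powr - (k + m)))
      \<longlongrightarrow> (1 - 0) * (1 + 0) / (1 - 0)) at_top"
    using assms by (intro tendsto_intros neg) auto
  moreover have "\<forall>\<^sub>F x::real in at_top. (1 - x powr - k) * (1 + x powr - m) / (1 - x powr - (k + m))
      = (x powr k - 1) * (x powr m + 1) / (x powr (k + m) - 1)"
    using eventually_gt_at_top[of 1]
  proof eventually_elim
    case (elim x)
    then have nz: "x powr k \<noteq> 0" "x powr m \<noteq> 0"
      by simp_all
    have "(1 - x powr - k) * (1 + x powr - m) / (1 - x powr - (k + m))
      = ((x powr k * x powr m) * ((1 - x powr - k) * (1 + x powr - m)))
        / ((x powr k * x powr m) * (1 - x powr - (k + m)))"
      using nz by simp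
    also have "(x powr k * x powr m) * ((1 - x powr - k) * (1 + x powr - m))
      = (x powr k - 1) * (x powr m + 1)"
      unfolding powr_minus_divide using nz by (simp add: algebra_simps)
    also have "(x powr k * x powr m) * (1 - x powr - (k + m)) = x powr (k + m) - 1"
      unfolding powr_minus_divide powr_add using nz by (simp add: algebra_simps)
    finally show ?case .
  qed
  ultimately show ?thesis
    using tendsto_cong by force
qed

section \<open>Choice of the matrices\<close>

theorem theorem4p8:
  fixes \<alpha> p q :: real
  assumes "0 < \<alpha>" "\<alpha> < 1" "0 < p" "0 < q"
  shows "\<exists>A B :: real^2^2. pos_def A \<and> pos_def B
           \<and> \<not> near_le (R_mean \<alpha> p A B) (A_mean \<alpha> q A B)
           \<and> \<not> loewner_le (R_mean \<alpha> p A B) (A_mean \<alpha> q A B)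
           \<and> \<not> chaotic_le (R_mean \<alpha> p A B) (A_mean \<alpha> q A B)"
proof -
  \<comment> \<open>The slope from \<open>tangent_R_mean\<close> at \<open>y = 1\<close>. Its limit
    1 differs from \<open>1 - \<alpha>\<close> since \<alpha> is positive, so a large
    \<open>x\<close> separates the two means.\<close>
  let ?slope = "\<lambda>x::real. (x powr ((1-\<alpha>)/2*p) - 1) * (x powr ((1+\<alpha>)/2*p) + 1) / (x powr p - 1)"
  have "\<forall>\<^sub>F x in at_top. ?slope x \<noteq> 1 - \<alpha>"
  proof (rule tendsto_imp_eventually_ne)
    have "(1-\<alpha>)/2*p + (1+\<alpha>)/2*p = p"
      by (simp add: field_simps)
    then show "(?slope \<longlongrightarrow> 1) at_top"
      using R_mean_slope_tendsto[of "(1-\<alpha>)/2*p" "(1+\<alpha>)/2*p"] assms by simp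
  qed (use assms in simp)
  then have "\<forall>\<^sub>F x in at_top. ?slope x \<noteq> 1 - \<alpha> \<and> 1 < x"
    using eventually_gt_at_top[of "1::real"] by eventually_elim simp
  then obtain x where x: "?slope x \<noteq> 1 - \<alpha>" "1 < x"
    by (auto simp: eventually_at_top_linorder)
  define w where "w = sqrt x"
  have w: "1 < w" "x = w\<^sup>2"
    using x by (simp_all add: w_def)
  let ?A = "sym2 x 1" and ?B = "sym2 x 1 0"
  have R: "tangent (\<lambda>t. R_mean \<alpha> p (?A t) ?B) x 1 (?slope x)"
    using tangent_R_mean[OF tangent_sym2 tangent_sym2_const, of x 1 p \<alpha>] x assms by simp
  have M: "tangent (\<lambda>t. A_mean \<alpha> q (?A t) ?B) x 1 (1 - \<alpha>)"
    using tangent_A_mean[OF tangent_sym2 tangent_sym2_const, of x 1 q \<alpha>] x assms by simp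
  have near: "\<forall>\<^sub>F t in at_right 0. \<not> near_le (R_mean \<alpha> p (?A t) ?B) (A_mean \<alpha> q (?A t) ?B)"
    by (rule tangent_not_near[where w = w]) (use R M w x(1) in simp_all)
  have chaotic: "\<forall>\<^sub>F t in at_right 0. \<not> chaotic_le (R_mean \<alpha> p (?A t) ?B) (A_mean \<alpha> q (?A t) ?B)"
    using tangent_not_chaotic[OF R M x(1)] x(2) by simp
  \<comment> \<open>With \<open>1 < x\<close>, every \<open>t\<close> in (0, 1) keeps the
    determinant \<open>x - t\<^sup>2\<close> of \<open>?A t\<close> positive.\<close>
  have "\<forall>\<^sub>F t in at_right 0. t < (1::real)"
    by (intro eventually_at_right_field[THEN iffD2]) (auto intro: exI[of _ 1])
  moreover have "\<forall>\<^sub>F t in at_right (0::real). 0 < t"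
    by (simp add: eventually_at_right_less)
  moreover note near tangent_not_loewner[OF R M x(1)] chaotic
  ultimately have "\<forall>\<^sub>F t in at_right 0. pos_def (?A t)
      \<and> \<not> near_le (R_mean \<alpha> p (?A t) ?B) (A_mean \<alpha> q (?A t) ?B)
      \<and> \<not> loewner_le (R_mean \<alpha> p (?A t) ?B) (A_mean \<alpha> q (?A t) ?B)
      \<and> \<not> chaotic_le (R_mean \<alpha> p (?A t) ?B) (A_mean \<alpha> q (?A t) ?B)"
  proof eventually_elim
    case (elim t)
    have "t\<^sup>2 < 1"
      using elim by (simp add: power_less_one_iff)
    then show ?case
      using elim x by (auto intro!: pos_def_sym2)
  qed
  \<comment> \<open>The filter \<open>at_right 0\<close> is nontrivial, so a single \<open>t\<close>
    defeats all three orders.\<close>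
  then obtain t where "pos_def (?A t)
      \<and> \<not> near_le (R_mean \<alpha> p (?A t) ?B) (A_mean \<alpha> q (?A t) ?B)
      \<and> \<not> loewner_le (R_mean \<alpha> p (?A t) ?B) (A_mean \<alpha> q (?A t) ?B)
      \<and> \<not> chaotic_le (R_mean \<alpha> p (?A t) ?B) (A_mean \<alpha> q (?A t) ?B)"
    using eventually_happens trivial_limit_at_right_real by blast
  moreover have "pos_def ?B"
    using x by (intro pos_def_sym2) auto
  ultimately show ?thesis
    by blast
qed

end
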